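(* Let $\lambda\in(0,1)$, let $m\ge 3$ be an integer, and let $k_1>k_2>\cdots>k_n\ge 2$ be integers ($n\ge 1$). Let ${\bf a},{\bf b}\in\mathbb{A}_{k_1,\ldots,k_n}$ (with respect to these same $\lambda$ and $m$). If $\#\gamma_\ell({\bf a})=\#\gamma_\ell({\bf b})$ for every $1\le \ell\le n$, then the self-similar sets $K_{\bf a}$ and $K_{\bf b}$ are Lipschitz equivalent, i.e. $K_{\bf a}\simeq K_{\bf b}$.
   Context: Lipschitz equivalence: nonempty subsets $A_1\subseteq X_1$, $A_2\subseteq X_2$ of metric spaces $(X_1,d_1)$, $(X_2,d_2)$ are Lipschitz equivalent, written $A_1\simeq A_2$, if there are a bijection $\phi:A_1\to A_2$ and a constant $c>0$ with $c^{-1}d_1(x,y)\le d_2(\phi(x),\phi(y))\le c\,d_1(x,y)$ for all $x,y\in A_1$. Subsets of $\mathbb{R}$ carry the usual metric. Fix $\lambda\in(0,1)$ and an integer $m\ge 3$. For a vector ${\bf a}=(a_1,\ldots,a_m)\in\mathbb{R}^m$ consider the maps $f_i:\mathbb{R}\to\mathbb{R}$, $f_i(x)=\lambda x+a_i$, $1\le i\le m$. The set $K_{\bf a}$ is the unique nonempty compact subset of $\mathbb{R}$ with $K_{\bf a}=\bigcup_{1\le i\le m}f_i(K_{\bf a})$. For integers $k_1>k_2>\cdots>k_n\ge 2$, $\mathbb{A}_{k_1,\ldots,k_n}$ is the collection of all ${\bf a}=(a_1,\ldots,a_m)\in\mathbb{R}^m$ satisfying: (I) $0=a_1<a_2<\cdots<a_m=1-\lambda$;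 (II) any three (distinct-index) intervals among $f_i([0,1])$, $1\le i\le m$, have empty common intersection; and whenever $i<j$ and $f_i([0,1])\cap f_j([0,1])\ne\emptyset$, the length $|f_i([0,1])\cap f_j([0,1])|$ belongs to $\{\lambda^{k_1},\ldots,\lambda^{k_n}\}$; (III) either $f_1([0,1])\cap f_j([0,1])=\emptyset$ for all $j>1$, or $f_m([0,1])\cap f_j([0,1])=\emptyset$ for all $j<m$. Here $|J|$ denotes the length of an interval $J$. For ${\bf a}\in\mathbb{A}_{k_1,\ldots,k_n}$ and $1\le\ell\le n$, $\gamma_\ell({\bf a})=\{1\le i\le m-1:\ |f_i([0,1])\cap f_{i+1}([0,1])|=\lambda^{k_\ell}\}$. $\#S$ denotes the number of elements of a finite set $S$. *)

theory Defs
  imports "HOL-Analysis.Analysis"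
begin

definition lipschitz_equivalent :: "'a::metric_space set \<Rightarrow> 'b::metric_space set \<Rightarrow> bool"
    (infix "\<simeq>\<^sub>L" 50) where
  "A \<simeq>\<^sub>L B \<longleftrightarrow> A \<noteq> {} \<and> B \<noteq> {} \<and>
     (\<exists>\<phi> c. bij_betw \<phi> A B \<and> c > 0 \<and>
        (\<forall>x\<in>A. \<forall>y\<in>A. inverse c * dist x y \<le> dist (\<phi> x) (\<phi> y) \<and>
                        dist (\<phi> x) (\<phi> y) \<le> c * dist x y))"

text \<open>
  A vector \<open>(a_1, ..., a_m)\<close> is a function \<open>a :: nat \<Rightarrow> real\<close> of which only the
  values at the indices \<open>1, ..., m\<close> are used; likewise \<open>(k_1, ..., k_n)\<close> is a function
  \<open>k :: nat \<Rightarrow> nat\<close> used only at \<open>1, ..., n\<close>.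
\<close>

definition ifs_map :: "real \<Rightarrow> (nat \<Rightarrow> real) \<Rightarrow> nat \<Rightarrow> real \<Rightarrow> real" where
  "ifs_map r a i x = r * x + a i"

text \<open>
  The description below is proper, by Hutchinson's theorem, whenever \<open>0 < r < 1\<close>
  and \<open>m \<ge> 1\<close>.
\<close>

definition self_similar_set :: "real \<Rightarrow> nat \<Rightarrow> (nat \<Rightarrow> real) \<Rightarrow> real set" where
  "self_similar_set r m a =
     (THE K. K \<noteq> {} \<and> compact K \<and> K = (\<Union>i\<in>{1..m}. ifs_map r a i ` K))"

definition cell :: "real \<Rightarrow> (nat \<Rightarrow> real) \<Rightarrow> nat \<Rightarrow> real set" where
  "cell r a i = ifs_map r a i ` {0..1}"

text \<open>
  The length of an interval is its Lebesgue measure. Cells meeting in a single point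
  are excluded by the pairwise overlap condition, as \<open>0\<close> is not a power of \<open>r\<close>.
\<close>

definition admissible_vectors ::
    "real \<Rightarrow> nat \<Rightarrow> nat \<Rightarrow> (nat \<Rightarrow> nat) \<Rightarrow> (nat \<Rightarrow> real) set" where
  "admissible_vectors r m n k = {a.
     (a 1 = 0 \<and> strict_mono_on {1..m} a \<and> a m = 1 - r) \<and>
     (\<forall>i\<in>{1..m}. \<forall>j\<in>{1..m}. \<forall>l\<in>{1..m}.
        i \<noteq> j \<and> j \<noteq> l \<and> i \<noteq> l \<longrightarrow> cell r a i \<inter> cell r a j \<inter> cell r a l = {}) \<and>
     (\<forall>i\<in>{1..m}. \<forall>j\<in>{1..m}. i < j \<and> cell r a i \<inter> cell r a j \<noteq> {} \<longrightarrow>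
        measure lborel (cell r a i \<inter> cell r a j) \<in> (\<lambda>l. r ^ k l) ` {1..n}) \<and>
     ((\<forall>j\<in>{1..m}. j > 1 \<longrightarrow> cell r a 1 \<inter> cell r a j = {}) \<or>
      (\<forall>j\<in>{1..m}. j < m \<longrightarrow> cell r a m \<inter> cell r a j = {}))}"

definition overlap_indices ::
    "real \<Rightarrow> nat \<Rightarrow> (nat \<Rightarrow> nat) \<Rightarrow> nat \<Rightarrow> (nat \<Rightarrow> real) \<Rightarrow> nat set" where
  "overlap_indices r m k l a =
     {i \<in> {1..m - 1}. measure lborel (cell r a i \<inter> cell r a (i + 1)) = r ^ k l}"

end

theory Submission
  imports Defs "HOL-Combinatorics.Permutations"
begin

text \<open>
  The two sets are coded by the same symbolic space, up to a renaming of the alphabet, in such a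
  way that the distance of two points is comparable to \<open>r ^ n\<close>, where \<open>n\<close> is the first place
  at which their codes differ.

  Write \<open>f_i\<close> for the maps and suppose that the last cell is isolated. If the cells \<open>i\<close> and
  \<open>i + 1\<close> overlap in length \<open>r ^ v\<close>, then \<open>a (i + 1) = a i + r - r ^ v\<close>; since \<open>f_1\<close> fixes \<open>0\<close>
  and \<open>f_m\<close> fixes \<open>1\<close>, this says that the maps \<open>f_i f_m^(v - 1)\<close> and \<open>f_(i+1) f_1^(v - 1)\<close>
  are equal. Each such coincidence is resolved in favour of the second expression: only the
  sequences over \<open>{1..m}\<close> that avoid every word \<open>i m ... m\<close> with \<open>v - 1\<close> letters \<open>m\<close> are used
  as codes (\<open>overlap_free_seqs\<close>).

  Every point has such a code, namely the one that takes the largest possible digit at each step: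
  a forbidden word starting at a digit \<open>i\<close> would allow the digit \<open>i + 1\<close> instead
  (\<open>itinerary_overlap_free\<close>). Two codes with different first digits \<open>i < j\<close> give points at a
  distance bounded below: the second point is at least \<open>a (i + 1)\<close>, and the first one stays
  away from \<open>a (i + 1)\<close>, either because the cells are disjoint or because one of the \<open>v - 1\<close>
  digits after \<open>i\<close> is not \<open>m\<close>, so that the gap before the isolated last cell, suitably scaled,
  separates it from \<open>a (i + 1)\<close> (\<open>point_separated\<close>). The symbolic space is invariant under the
  shift, so rescaling yields the bounds for codes with a common prefix (\<open>coding\<close>).

  If the first cell is isolated instead, the reflection \<open>x \<mapsto> 1 - x\<close> exchanges the two cases and
  reverses the order of the overlap exponents. The hypothesis on the numbers of overlaps therefore
  provides a permutation of \<open>{1..<m}\<close> that carries the overlap exponents of one system to those of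
  the other. As it is extended by fixing \<open>m\<close>, it maps forbidden words to forbidden words, hence one
  symbolic space onto the other, and it preserves the first place at which two codes differ.
\<close>

section \<open>Contracting families of similarities on the line\<close>

text \<open>
  Unfolding the cover of \<open>S\<close> by its images \<open>n\<close> times and following the same maps from a point of
  \<open>K\<close> approximates each point of \<open>S\<close> by a point of \<open>K\<close> with an error of order \<open>r ^ n\<close>. This
  gives the uniqueness of the attractor, its inclusion in the unit interval, and the fact that
  every sequence of digits codes one of its points.
\<close>

lemma subset_of_invariant_closed:
  fixes r :: real
  assumes r: "0 \<le> r" "r < 1"
    and S: "bounded S" "S \<subseteq> (\<Union>i\<in>I. ifs_map r a i ` S)"
    and K: "closed K" "K \<noteq> {}" "\<And>i. i \<in> I \<Longrightarrow> ifs_map r a i ` K \<subseteq> K"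
  shows "S \<subseteq> K"
proof
  obtain y0 where y0: "y0 \<in> K" using K by blast
  obtain C where C: "\<And>x. x \<in> S \<Longrightarrow> dist y0 x \<le> C"
    using S(1) bounded_any_center by metis
  have approx: "\<exists>y\<in>K. \<bar>x - y\<bar> \<le> r ^ n * C" if "x \<in> S" for x n
    using that
  proof (induction n arbitrary: x)
    case 0
    then show ?case using C y0 by (force simp: dist_real_def abs_minus_commute)
  next
    case (Suc n)
    obtain i x' where i: "i \<in> I" "x' \<in> S" "x = r * x' + a i"
      using Suc.prems S(2) by (fastforce simp: ifs_map_def)
    obtain y' where y': "y' \<in> K" "\<bar>x' - y'\<bar> \<le> r ^ n * C" using Suc.IH i by blast
    have "r * y' + a i \<in> K" using K(3)[OF i(1)] y' by (auto simp: ifs_map_def)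
    moreover have "\<bar>x - (r * y' + a i)\<bar> = r * \<bar>x' - y'\<bar>"
      using i r by (simp add: abs_mult flip: right_diff_distrib)
    moreover have "r * \<bar>x' - y'\<bar> \<le> r * (r ^ n * C)" using y' r by (intro mult_left_mono)
    ultimately show ?case by (intro bexI[of _ "r * y' + a i"]) (simp_all add: mult.assoc)
  qed
  fix x assume x: "x \<in> S"
  have lim: "(\<lambda>n. r ^ n * C) \<longlonglongrightarrow> 0 * C"
    by (intro tendsto_mult LIMSEQ_realpow_zero tendsto_const r)
  have "x \<in> closure K"
    unfolding closure_approachable
  proof safe
    fix \<epsilon> :: real assume "\<epsilon> > 0"
    then have "\<forall>\<^sub>F n in sequentially. r ^ n * C < \<epsilon>" using lim by (simp add: order_tendsto_iff)
    then obtain n where "r ^ n * C < \<epsilon>" by (auto simp: eventually_sequentially)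
    then show "\<exists>y\<in>K. dist y x < \<epsilon>"
      using approx[OF x, of n] by (force simp: dist_real_def abs_minus_commute)
  qed
  then show "x \<in> K" using K(1) by simp
qed

definition attractor :: "real \<Rightarrow> nat \<Rightarrow> (nat \<Rightarrow> real) \<Rightarrow> real set \<Rightarrow> bool" where
  "attractor r m a K \<longleftrightarrow> K \<noteq> {} \<and> compact K \<and> K = (\<Union>i\<in>{1..m}. ifs_map r a i ` K)"

lemma attractor_unique:
  assumes r: "0 < r" "r < 1" and K: "attractor r m a K" and L: "attractor r m a L"
  shows "K = L"
proof -
  have sub: "P \<subseteq> Q" if "attractor r m a P" "attractor r m a Q" for P Q
  proof (rule subset_of_invariant_closed[where r = r and I = "{1..m}" and a = a])
    show "bounded P" "closed Q" "Q \<noteq> {}" "P \<subseteq> (\<Union>i\<in>{1..m}. ifs_map r a i ` P)"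
      using that by (auto simp: attractor_def intro: compact_imp_bounded compact_imp_closed)
    show "ifs_map r a i ` Q \<subseteq> Q" if "i \<in> {1..m}" for i
      using \<open>attractor r m a Q\<close> that unfolding attractor_def by blast
  qed (use r in auto)
  show ?thesis using sub K L by blast
qed

text \<open>
  The attractor is the intersection of the decreasing compact sets obtained by iterating the union
  of the maps on \<open>[0,1]\<close>; it contains \<open>0\<close>, the fixed point of the first map.
\<close>

lemma attractor_exists:
  assumes r: "0 < r" "r < 1" and m: "1 \<le> m" and a1: "a 1 = 0"
    and a: "\<And>i. i \<in> {1..m} \<Longrightarrow> 0 \<le> a i \<and> a i \<le> 1 - r"
  shows "\<exists>K. attractor r m a K"
proof -
  define F where "F A = (\<Union>i\<in>{1..m}. ifs_map r a i ` A)" for A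
  define A where "A n = (F ^^ n) {0..1}" for n
  have A0: "A 0 = {0..1}" and AS: "A (Suc n) = F (A n)" for n by (simp_all add: A_def)
  have mono: "F P \<subseteq> F Q" if "P \<subseteq> Q" for P Q using that by (auto simp: F_def)
  have "F {0..1} \<subseteq> {0..1}"
  proof -
    have "r * x + a i \<in> {0..1}" if "x \<in> {0..1}" "i \<in> {1..m}" for x i
    proof -
      have "0 \<le> r * x" "r * x \<le> r * 1" using that r by (auto intro!: mult_left_mono)
      then show ?thesis using a[OF that(2)] by auto
    qed
    then show ?thesis by (auto simp: F_def ifs_map_def)
  qed
  then have dec1: "A (Suc n) \<subseteq> A n" for n
    by (induction n) (use mono in \<open>auto simp: A0 AS\<close>)
  then have dec: "A n' \<subseteq> A n" if "n \<le> n'" for n n'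
    using that by (metis lift_Suc_antimono_le)
  have cpt: "compact (A n)" for n
  proof (induction n)
    case (Suc n)
    then show ?case unfolding AS F_def ifs_map_def[abs_def]
      by (intro compact_UN compact_continuous_image continuous_intros) auto
  qed (simp add: A0)
  have zero: "0 \<in> A n" for n
  proof (induction n)
    case (Suc n)
    then have "ifs_map r a 1 0 \<in> F (A n)" using m by (force simp: F_def)
    then show ?case using a1 by (simp add: AS ifs_map_def)
  qed (simp add: A0)
  define K where "K = (\<Inter>n. A n)"
  have "K = F K"
  proof
    show "F K \<subseteq> K"
    proof
      fix x assume "x \<in> F K"
      then have "x \<in> A (Suc n)" for n using mono[of K "A n"] by (auto simp: AS K_def)
      then show "x \<in> K" using dec1 by (auto simp: K_def)
    qed
    show "K \<subseteq> F K"
    proof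
      fix x assume x: "x \<in> K"
      then have "\<forall>n. \<exists>i\<in>{1..m}. x \<in> ifs_map r a i ` A n"
        using AS unfolding K_def F_def by blast
      then obtain s where s: "\<And>n. s n \<in> {1..m}" "\<And>n. x \<in> ifs_map r a (s n) ` A n" by metis
      \<comment> \<open>A single map must serve infinitely many levels, hence, the levels being nested, all of them.\<close>
      have "\<exists>i\<in>{1..m}. infinite {n. s n = i}"
      proof (rule ccontr)
        assume "\<not> ?thesis"
        then have "finite (\<Union>i\<in>{1..m}. {n. s n = i})" by (intro finite_UN_I) auto
        moreover have "(\<Union>i\<in>{1..m}. {n. s n = i}) = UNIV" using s(1) by blast
        ultimately show False using infinite_UNIV_nat by metis
      qed
      then obtain i where i: "i \<in> {1..m}" "infinite {n. s n = i}" by blast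
      have "(x - a i) / r \<in> A n" for n
      proof -
        obtain n' where "n' \<ge> n" "s n' = i" using i(2) unfolding infinite_nat_iff_unbounded_le by blast
        then show ?thesis using s(2)[of n'] r dec by (fastforce simp: ifs_map_def)
      qed
      then have "(x - a i) / r \<in> K" by (simp add: K_def)
      moreover have "x = ifs_map r a i ((x - a i) / r)" using r by (simp add: ifs_map_def)
      ultimately show "x \<in> F K" using i(1) by (auto simp: F_def)
    qed
  qed
  moreover have "compact K" unfolding K_def
    using cpt by (intro compact_Inter) auto
  moreover have "K \<noteq> {}" using zero by (auto simp: K_def)
  ultimately show ?thesis unfolding attractor_def F_def by blast
qed

lemma attractor_self_similar_set:
  assumes "0 < r" "r < 1" "1 \<le> m" "a 1 = 0"
    and "\<And>i. i \<in> {1..m} \<Longrightarrow> 0 \<le> a i \<and> a i \<le> 1 - r"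
  shows "attractor r m a (self_similar_set r m a)"
proof -
  obtain K where K: "attractor r m a K"
    using attractor_exists[of r m a, OF assms] by blast
  have "(THE K. attractor r m a K) = K"
    using K by (rule the_equality) (rule attractor_unique[OF assms(1,2) _ K])
  then show ?thesis using K by (simp add: self_similar_set_def attractor_def)
qed

section \<open>Coding by sequences with forbidden words\<close>

text \<open>
  The number \<open>e i\<close> is the exponent of the overlap of the cells \<open>i\<close> and \<open>i + 1\<close>; the value \<open>0\<close>
  stands for disjoint cells. The guard \<open>w n < m\<close> is there because the last cell has no successor.
\<close>

definition overlap_free_seqs :: "nat \<Rightarrow> (nat \<Rightarrow> nat) \<Rightarrow> (nat \<Rightarrow> nat) set" where
  "overlap_free_seqs m e = {w. \<forall>n. w n \<in> {1..m} \<and>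
     (w n < m \<longrightarrow> e (w n) \<noteq> 0 \<longrightarrow> (\<exists>p\<in>{1..<e (w n)}. w (n + p) \<noteq> m))}"

text \<open>
  A bi-Lipschitz parametrisation of \<open>K\<close> by \<open>W\<close>, for the ultrametric on sequences in which the
  distance is \<open>r ^ n\<close> when \<open>n\<close> is the first place of disagreement.
\<close>

definition bilipschitz_coding ::
    "real \<Rightarrow> (nat \<Rightarrow> nat) set \<Rightarrow> ((nat \<Rightarrow> nat) \<Rightarrow> 'a::metric_space) \<Rightarrow> 'a set \<Rightarrow> bool" where
  "bilipschitz_coding r W h K \<longleftrightarrow> bij_betw h W K \<and>
     (\<exists>\<delta>>0. \<forall>w\<in>W. \<forall>v\<in>W. \<forall>n. (\<forall>i<n. w i = v i) \<longrightarrow> w n \<noteq> v n \<longrightarrow>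
        \<delta> * r ^ n \<le> dist (h w) (h v) \<and> dist (h w) (h v) \<le> r ^ n)"

text \<open>
  The normalisation in which the last cell is isolated, expressed by \<open>e (m - 1) = 0\<close>. The set \<open>K\<close>
  is a parameter characterised as an attractor, so that the reflection of a self-similar set can be
  used in its place.
\<close>

locale exact_overlap_ifs =
  fixes r :: real and m :: nat and a :: "nat \<Rightarrow> real" and e :: "nat \<Rightarrow> nat" and K :: "real set"
  assumes r: "0 < r" "r < 1"
    and m: "2 \<le> m"
    and a_first: "a 1 = 0" and a_last: "a m = 1 - r"
    and a_mono: "\<And>i j. 1 \<le> i \<Longrightarrow> i \<le> j \<Longrightarrow> j \<le> m \<Longrightarrow> a i \<le> a j"
    and disjoint: "\<And>i. 1 \<le> i \<Longrightarrow> i < m \<Longrightarrow> e i = 0 \<Longrightarrow> a i + r < a (i + 1)"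
    and overlap: "\<And>i. 1 \<le> i \<Longrightarrow> i < m \<Longrightarrow> e i \<noteq> 0 \<Longrightarrow> a (i + 1) = a i + r - r ^ e i"
    and e_last: "e (m - 1) = 0"
    and K: "attractor r m a K"
begin

lemma a_bounds: "i \<in> {1..m} \<Longrightarrow> 0 \<le> a i \<and> a i \<le> 1 - r"
  using a_mono[of 1 i] a_mono[of i m] a_first a_last m by auto

lemma K_closed: "closed K" and K_bounded: "bounded K" and K_nonempty: "K \<noteq> {}"
  using K by (auto simp: attractor_def intro: compact_imp_bounded compact_imp_closed)

lemma K_step: "i \<in> {1..m} \<Longrightarrow> x \<in> K \<Longrightarrow> r * x + a i \<in> K"
  using K unfolding attractor_def ifs_map_def[abs_def] by blast

lemma K_cover: "x \<in> K \<Longrightarrow> \<exists>i\<in>{1..m}. \<exists>y\<in>K. x = r * y + a i"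
  using K unfolding attractor_def ifs_map_def[abs_def] by blast

definition point :: "(nat \<Rightarrow> nat) \<Rightarrow> real" where
  "point w = (\<Sum>n. r ^ n * a (w n))"

abbreviation seqs :: "(nat \<Rightarrow> nat) set" where
  "seqs \<equiv> {w. \<forall>n. w n \<in> {1..m}}"

lemma seqs_shift: "w \<in> seqs \<Longrightarrow> w \<circ> Suc \<in> seqs"
  by auto

lemma term_bounds:
  assumes "w \<in> seqs" shows "0 \<le> r ^ n * a (w n)" "r ^ n * a (w n) \<le> r ^ n * (1 - r)"
  using a_bounds[of "w n"] assms r by (auto intro!: mult_nonneg_nonneg mult_left_mono)

lemma geometric: "(\<lambda>n. r ^ n * (1 - r)) sums 1"
  using sums_mult2[OF geometric_sums[of r], of "1 - r"] r by simp

lemma summable_point: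
  assumes "w \<in> seqs" shows "summable (\<lambda>n. r ^ n * a (w n))"
proof (rule summable_comparison_test'[OF sums_summable[OF geometric]])
  show "norm (r ^ n * a (w n)) \<le> r ^ n * (1 - r)" if "0 \<le> n" for n
    using term_bounds[OF assms, of n] by (simp add: abs_of_nonneg)
qed

lemma point_bounds:
  assumes "w \<in> seqs" shows "0 \<le> point w" "point w \<le> 1"
proof -
  show "0 \<le> point w" unfolding point_def
    using term_bounds[OF assms] by (intro suminf_nonneg summable_point assms)
  have "point w \<le> (\<Sum>n. r ^ n * (1 - r))" unfolding point_def
    using term_bounds[OF assms]
    by (intro suminf_le summable_point assms sums_summable[OF geometric])
  then show "point w \<le> 1" using sums_unique[OF geometric] by simp
qed

lemma point_step:
  assumes "w \<in> seqs" shows "point w = r * point (w \<circ> Suc) + a (w 0)"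
proof -
  have "point w = (\<Sum>n. r * (r ^ n * a (w (Suc n)))) + a (w 0)"
    unfolding point_def using suminf_split_head[OF summable_point[OF assms]]
    by (simp add: mult.assoc)
  also have "(\<Sum>n. r * (r ^ n * a (w (Suc n)))) = r * point (w \<circ> Suc)"
    unfolding point_def using suminf_mult[OF summable_point[OF seqs_shift[OF assms]]]
    by simp
  finally show ?thesis .
qed

lemma point_in_K:
  assumes "w \<in> seqs" shows "point w \<in> K"
proof -
  have "point ` seqs \<subseteq> K"
  proof (rule subset_of_invariant_closed[where r = r and I = "{1..m}" and a = a])
    show "bounded (point ` seqs)"
      using point_bounds by (intro bounded_subset[OF bounded_closed_interval[of 0 1]]) auto
    show "point ` seqs \<subseteq> (\<Union>i\<in>{1..m}. ifs_map r a i ` point ` seqs)"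
    proof
      fix x assume "x \<in> point ` seqs"
      then obtain w where w: "w \<in> seqs" "x = point w" by blast
      then have "x = ifs_map r a (w 0) (point (w \<circ> Suc))"
        unfolding ifs_map_def using point_step[OF w(1)] by metis
      moreover have "w 0 \<in> {1..m}" using w by blast
      ultimately show "x \<in> (\<Union>i\<in>{1..m}. ifs_map r a i ` point ` seqs)"
        using seqs_shift[OF w(1)] by blast
    qed
  qed (use r K_closed K_nonempty K_step in \<open>auto simp: ifs_map_def\<close>)
  then show ?thesis using assms by blast
qed

lemma K_subset_unit: "K \<subseteq> {0..1}"
proof (rule subset_of_invariant_closed[where r = r and I = "{1..m}" and a = a])
  show "K \<subseteq> (\<Union>i\<in>{1..m}. ifs_map r a i ` K)" using K_cover by (force simp: ifs_map_def)
  show "ifs_map r a i ` {0..1} \<subseteq> {0..1}" if "i \<in> {1..m}" for i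
  proof -
    have "0 \<le> r * x" "r * x \<le> r * 1" if "x \<in> {0..1}" for x
      using that r by (auto intro!: mult_left_mono)
    then show ?thesis using a_bounds[OF that] by (fastforce simp: ifs_map_def)
  qed
qed (use r K_bounded in auto)

text \<open>
  The greedy expansion. Taking the greatest admissible digit is what excludes the forbidden words.
\<close>

definition digit :: "real \<Rightarrow> nat" where
  "digit x = Max {i \<in> {1..m}. \<exists>y\<in>K. x = r * y + a i}"

definition remainder :: "real \<Rightarrow> real" where
  "remainder x = (x - a (digit x)) / r"

definition itinerary :: "real \<Rightarrow> nat \<Rightarrow> nat" where
  "itinerary x n = digit ((remainder ^^ n) x)"

lemma digit:
  assumes "x \<in> K"
  shows digit_range: "digit x \<in> {1..m}" and remainder_in_K: "remainder x \<in> K"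
    and remainder_eq: "x = r * remainder x + a (digit x)"
proof -
  have "digit x \<in> {i \<in> {1..m}. \<exists>y\<in>K. x = r * y + a i}"
    unfolding digit_def using K_cover[OF assms] by (intro Max_in) auto
  then obtain y where y: "digit x \<in> {1..m}" "y \<in> K" "x = r * y + a (digit x)" by blast
  then have "remainder x = y" using r unfolding remainder_def by (simp add: field_simps)
  then show "digit x \<in> {1..m}" "remainder x \<in> K" "x = r * remainder x + a (digit x)"
    using y by auto
qed

lemma digit_greatest: "y \<in> K \<Longrightarrow> i \<in> {1..m} \<Longrightarrow> i \<le> digit (r * y + a i)"
  unfolding digit_def by (intro Max_ge) auto

lemma remainder_power_in_K: "x \<in> K \<Longrightarrow> (remainder ^^ n) x \<in> K"
  by (induction n) (auto intro: remainder_in_K)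

lemma itinerary_0: "itinerary x 0 = digit x"
  by (simp add: itinerary_def)

lemma itinerary_add: "itinerary x (n + p) = itinerary ((remainder ^^ n) x) p"
  by (simp add: itinerary_def add.commute[of n] funpow_add)

lemma itinerary_Suc: "itinerary x (Suc p) = itinerary (remainder x) p"
  using itinerary_add[of x 1 p] by simp

lemma itinerary_seqs: "x \<in> K \<Longrightarrow> itinerary x \<in> seqs"
  using digit_range remainder_power_in_K by (simp add: itinerary_def)

lemma point_itinerary:
  assumes "x \<in> K" shows "point (itinerary x) = x"
proof -
  have approx: "\<bar>point (itinerary x) - x\<bar> \<le> r ^ n" if "x \<in> K" for x n
    using that
  proof (induction n arbitrary: x)
    case 0
    then show ?case
      using point_bounds[OF itinerary_seqs[OF 0]] K_subset_unit by fastforce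
  next
    case (Suc n)
    have "point (itinerary x) = r * point (itinerary (remainder x)) + a (digit x)"
      using point_step[OF itinerary_seqs[OF Suc.prems]]
      by (simp add: itinerary_0 comp_def itinerary_Suc)
    then have "point (itinerary x) - x = r * (point (itinerary (remainder x)) - remainder x)"
      using remainder_eq[OF Suc.prems] by (simp add: algebra_simps)
    then show ?case
      using Suc.IH[OF remainder_in_K[OF Suc.prems]] r by (simp add: abs_mult)
  qed
  have "(\<lambda>n. r ^ n) \<longlonglongrightarrow> 0" using r by (intro LIMSEQ_realpow_zero) auto
  then have "\<bar>point (itinerary x) - x\<bar> \<le> 0"
    using approx[OF assms] by (intro LIMSEQ_le_const) auto
  then show ?thesis by simp
qed

text \<open>
  The \<open>q\<close>-th iterate of the last map is \<open>y \<mapsto> 1 - r ^ q + r ^ q * y\<close>.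
\<close>

lemma leading_last_digits:
  assumes "x \<in> K" "\<And>p. p < q \<Longrightarrow> itinerary x p = m"
  shows "\<exists>y\<in>K. x = 1 - r ^ q + r ^ q * y"
  using assms
proof (induction q arbitrary: x)
  case (Suc q)
  have "itinerary (remainder x) p = m" if "p < q" for p
    using Suc.prems(2)[of "Suc p"] that by (simp add: itinerary_Suc)
  then obtain y where y: "y \<in> K" "remainder x = 1 - r ^ q + r ^ q * y"
    using Suc.IH remainder_in_K[OF Suc.prems(1)] by blast
  have "digit x = m" using Suc.prems(2)[of 0] by (simp add: itinerary_0)
  then have "x = r * (1 - r ^ q + r ^ q * y) + (1 - r)"
    using remainder_eq[OF Suc.prems(1)] y a_last by simp
  then show ?case using y(1) by (intro bexI[of _ y]) (auto simp: algebra_simps)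
qed auto

lemma scaled_in_K: "y \<in> K \<Longrightarrow> r ^ q * y \<in> K"
proof (induction q)
  case (Suc q)
  then show ?case using K_step[of 1 "r ^ q * y"] a_first m by (simp add: mult.assoc)
qed simp

text \<open>
  If the greedy expansion of \<open>z\<close> began with a forbidden word \<open>i m ... m\<close>, then \<open>z\<close> would be in the
  image of \<open>K\<close> under \<open>f_i f_m^q\<close> with \<open>q = e i - 1\<close>. That map equals \<open>f_(i+1) f_1^q\<close>, so \<open>i + 1\<close>
  would be a larger digit for \<open>z\<close>.
\<close>

lemma itinerary_overlap_free:
  assumes "x \<in> K" shows "itinerary x \<in> overlap_free_seqs m e"
proof -
  have "\<exists>p\<in>{1..<e (itinerary x n)}. itinerary x (n + p) \<noteq> m"
    if lt: "itinerary x n < m" and ov: "e (itinerary x n) \<noteq> 0" for n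
  proof (rule ccontr)
    assume neg: "\<not> ?thesis"
    define z where "z = (remainder ^^ n) x"
    define i where "i = digit z"
    have z: "z \<in> K" using remainder_power_in_K[OF assms] by (simp add: z_def)
    have i: "itinerary x n = i" by (simp add: i_def z_def itinerary_def)
    obtain q where q: "e i = Suc q" using ov i not0_implies_Suc by auto
    have i_range: "1 \<le> i" "i < m" using digit_range[OF z] lt i by (auto simp: i_def)
    have "itinerary (remainder z) p = m" if "p < q" for p
    proof -
      have "Suc p \<in> {1..<e (itinerary x n)}" using that q i by simp
      then have "itinerary x (n + Suc p) = m" using neg by blast
      then show ?thesis by (simp only: itinerary_add itinerary_Suc flip: z_def)
    qed
    then obtain y where y: "y \<in> K" "remainder z = 1 - r ^ q + r ^ q * y"
      using leading_last_digits[OF remainder_in_K[OF z]] by blast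
    have "z = r * (r ^ q * y) + a (i + 1)"
      using remainder_eq[OF z] y(2) overlap[OF i_range] q
      by (simp add: i_def algebra_simps)
    then have "i + 1 \<le> digit z"
      using digit_greatest[OF scaled_in_K[OF y(1), of q], of "i + 1"] i_range by simp
    then show False by (simp add: i_def)
  qed
  then show ?thesis using itinerary_seqs[OF assms] by (auto simp: overlap_free_seqs_def)
qed

abbreviation last_gap :: real where
  "last_gap \<equiv> a m - a (m - 1) - r"

lemma last_gap_pos: "0 < last_gap"
proof -
  have "m - 1 + 1 = m" "1 \<le> m - 1" "m - 1 < m" using m by auto
  then show ?thesis using disjoint[of "m - 1"] e_last by simp
qed

text \<open>
  The extremal case is a word of \<open>p\<close> letters \<open>m\<close> followed by \<open>m - 1\<close>: the point is then at most the
  right end of the corresponding cell, which lies below the left end \<open>1 - r ^ (p + 1)\<close> of the cell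
  of \<open>p + 1\<close> letters \<open>m\<close> by the \<open>p\<close> times rescaled last gap.
\<close>

lemma point_le_non_last_digit:
  assumes "w \<in> seqs" "w p \<noteq> m"
  shows "point w \<le> 1 - r ^ (p + 1) - r ^ p * last_gap"
  using assms
proof (induction p arbitrary: w)
  case (Suc p)
  have eq: "point w = r * point (w \<circ> Suc) + a (w 0)" by (rule point_step[OF Suc.prems(1)])
  have le: "point (w \<circ> Suc) \<le> 1 - r ^ (p + 1) - r ^ p * last_gap"
    using Suc.prems by (intro Suc.IH) auto
  have "r * point (w \<circ> Suc) \<le> r * (1 - r ^ (p + 1) - r ^ p * last_gap)"
    using le r by (intro mult_left_mono) auto
  moreover have "a (w 0) \<le> 1 - r" using a_bounds Suc.prems(1) by blast
  ultimately show ?case unfolding eq by (simp add: algebra_simps)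
next
  case 0
  have "w 0 \<in> {1..m}" using 0 by blast
  then have "1 \<le> w 0" "w 0 \<le> m - 1" using 0(2) by (simp_all, linarith)
  then have "a (w 0) \<le> a (m - 1)" by (intro a_mono) auto
  moreover have "r * point (w \<circ> Suc) \<le> r * 1"
    using point_bounds(2)[OF seqs_shift[OF 0(1)]] r by (intro mult_left_mono) auto
  ultimately show ?case
    unfolding point_step[OF 0(1)] using a_last by simp
qed

text \<open>
  A lower bound for the distance from \<open>a (i + 1)\<close> to the points whose code starts with \<open>i\<close>. For overlapping cells it is the last gap rescaled to the size of the overlap.
\<close>

definition separation :: "nat \<Rightarrow> real" where
  "separation i = (if e i = 0 then a (i + 1) - a i - r else r ^ e i * last_gap)"

lemma separation_pos: "1 \<le> i \<Longrightarrow> i < m \<Longrightarrow> 0 < separation i"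
  using disjoint[of i] last_gap_pos r by (auto simp: separation_def)

lemma overlap_free_subset: "overlap_free_seqs m e \<subseteq> seqs"
  by (auto simp: overlap_free_seqs_def)

lemma overlap_free_shift: "w \<in> overlap_free_seqs m e \<Longrightarrow> w \<circ> Suc \<in> overlap_free_seqs m e"
proof -
  assume w: "w \<in> overlap_free_seqs m e"
  show ?thesis unfolding overlap_free_seqs_def
  proof (intro CollectI allI)
    fix n
    show "(w \<circ> Suc) n \<in> {1..m} \<and> ((w \<circ> Suc) n < m \<longrightarrow> e ((w \<circ> Suc) n) \<noteq> 0 \<longrightarrow>
        (\<exists>p\<in>{1..<e ((w \<circ> Suc) n)}. (w \<circ> Suc) (n + p) \<noteq> m))"
      using w[unfolded overlap_free_seqs_def, simplified, rule_format, of "Suc n"] by auto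
  qed
qed

text \<open>
  It suffices to compare with the left end \<open>a (i + 1)\<close> of the next cell, where \<open>i = w 0\<close>, since
  every code starting with a larger digit has its point to the right of it. In the overlapping case
  \<open>a (i + 1)\<close> is the left end of the cell of the forbidden word, and \<open>w\<close> leaves this word at some
  digit, which by the previous bound keeps its point on the left of that cell.
\<close>

lemma point_separated:
  assumes w: "w \<in> overlap_free_seqs m e" and v: "v \<in> overlap_free_seqs m e" and lt: "w 0 < v 0"
  shows "point w + separation (w 0) \<le> point v"
proof -
  define i where "i = w 0"
  have ws: "w \<in> seqs" and vs: "v \<in> seqs" using w v overlap_free_subset by auto
  have "w 0 \<in> {1..m}" "v 0 \<in> {1..m}" using ws vs by auto
  then have i: "1 \<le> i" "i < m" and j: "i + 1 \<le> v 0" "v 0 \<le> m" using lt by (auto simp: i_def)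
  have "a (i + 1) \<le> a (v 0)" using j by (intro a_mono) auto
  also have "\<dots> \<le> point v"
    unfolding point_step[OF vs] using point_bounds(1)[OF seqs_shift[OF vs]] r by simp
  finally have v_ge: "a (i + 1) \<le> point v" .
  have w_eq: "point w = r * point (w \<circ> Suc) + a i"
    using point_step[OF ws] by (simp add: i_def)
  show ?thesis
  proof (cases "e i = 0")
    case True
    have "r * point (w \<circ> Suc) \<le> r * 1"
      using point_bounds(2)[OF seqs_shift[OF ws]] r by (intro mult_left_mono) auto
    then show ?thesis using True v_ge w_eq by (simp add: separation_def flip: i_def)
  next
    case False
    then obtain p where p: "p \<in> {1..<e i}" "w p \<noteq> m"
      using w i(2) unfolding overlap_free_seqs_def i_def by (auto dest!: spec[of _ 0])
    then obtain q where q: "p = Suc q" by (cases p) auto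
    have "point (w \<circ> Suc) \<le> 1 - r ^ (q + 1) - r ^ q * last_gap"
      using p q by (intro point_le_non_last_digit seqs_shift[OF ws]) auto
    then have "r * point (w \<circ> Suc) \<le> r * (1 - r ^ (q + 1) - r ^ q * last_gap)"
      using r by (intro mult_left_mono) auto
    also have "\<dots> = r - r ^ (p + 1) - r ^ p * last_gap"
      by (simp add: q algebra_simps)
    also have "\<dots> \<le> r - r ^ e i - r ^ e i * last_gap"
    proof -
      have "r ^ e i \<le> r ^ (p + 1)" "r ^ e i \<le> r ^ p"
        using p r by (intro power_decreasing; simp)+
      then have "r ^ e i * last_gap \<le> r ^ p * last_gap" 
        using last_gap_pos by (intro mult_right_mono) auto
      then show ?thesis using \<open>r ^ e i \<le> r ^ (p + 1)\<close> by linarith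
    qed
    finally have "point w + r ^ e i * last_gap \<le> a i + r - r ^ e i" using w_eq by linarith
    then show ?thesis
      using v_ge overlap[OF i False] False by (simp add: separation_def flip: i_def)
  qed
qed

lemma dist_point_common_prefix:
  assumes "w \<in> seqs" "v \<in> seqs" "\<And>i. i < n \<Longrightarrow> w i = v i"
  shows "dist (point w) (point v) = r ^ n * dist (point (\<lambda>i. w (n + i))) (point (\<lambda>i. v (n + i)))"
  using assms
proof (induction n arbitrary: w v)
  case (Suc n)
  have "dist (point w) (point v) = r * dist (point (w \<circ> Suc)) (point (v \<circ> Suc))"
    using point_step[OF Suc.prems(1)] point_step[OF Suc.prems(2)] Suc.prems(3)[of 0] r
    by (simp add: dist_real_def abs_mult flip: right_diff_distrib)
  also have "dist (point (w \<circ> Suc)) (point (v \<circ> Suc)) =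
      r ^ n * dist (point (\<lambda>i. (w \<circ> Suc) (n + i))) (point (\<lambda>i. (v \<circ> Suc) (n + i)))"
    using Suc.prems by (intro Suc.IH) auto
  finally show ?case by (simp add: mult.assoc)
qed simp

lemma overlap_free_drop:
  assumes "w \<in> overlap_free_seqs m e" shows "(\<lambda>i. w (n + i)) \<in> overlap_free_seqs m e"
proof (induction n)
  case (Suc n)
  then show ?case using overlap_free_shift[OF Suc] by (simp add: comp_def)
qed (use assms in simp)

lemma coding: "bilipschitz_coding r (overlap_free_seqs m e) point K"
proof -
  let ?W = "overlap_free_seqs m e"
  define \<delta> where "\<delta> = Min (separation ` {1..<m})"
  have ne: "{1..<m} \<noteq> {}" using m by auto
  have \<delta>: "0 < \<delta>" using ne separation_pos by (auto simp: \<delta>_def)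
  have \<delta>_le: "\<delta> \<le> separation i" if "1 \<le> i" "i < m" for i
    using that by (auto simp: \<delta>_def intro!: Min_le)
  have apart: "\<delta> \<le> dist (point w) (point v)" if "w \<in> ?W" "v \<in> ?W" "w 0 \<noteq> v 0" for w v
  proof -
    have *: "\<delta> \<le> point v' - point w'" if "w' \<in> ?W" "v' \<in> ?W" "w' 0 < v' 0" for w' v'
    proof -
      have "w' 0 \<in> {1..m}" "v' 0 \<in> {1..m}" using that overlap_free_subset by auto
      then show ?thesis using point_separated[OF that] \<delta>_le[of "w' 0"] that by auto
    qed
    show ?thesis using *[of w v] *[of v w] that by (auto simp: dist_real_def neq_iff)
  qed
  have bounds: "\<delta> * r ^ n \<le> dist (point w) (point v) \<and> dist (point w) (point v) \<le> r ^ n"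
    if w: "w \<in> ?W" and v: "v \<in> ?W" and eq: "\<forall>i<n. w i = v i" and neq: "w n \<noteq> v n" for w v n
  proof -
    let ?w = "\<lambda>i. w (n + i)" and ?v = "\<lambda>i. v (n + i)"
    have W: "?w \<in> ?W" "?v \<in> ?W" using w v by (auto intro: overlap_free_drop)
    have d: "dist (point w) (point v) = r ^ n * dist (point ?w) (point ?v)"
      using dist_point_common_prefix w v eq overlap_free_subset by blast
    have "\<delta> \<le> dist (point ?w) (point ?v)" using neq by (intro apart W) auto
    moreover have "dist (point ?w) (point ?v) \<le> 1"
      using point_bounds[OF subsetD[OF overlap_free_subset W(1)]]
        point_bounds[OF subsetD[OF overlap_free_subset W(2)]]
      by (simp add: dist_real_def)
    ultimately show ?thesis using r by (simp add: d mult.commute mult_left_le)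
  qed
  have "inj_on point ?W"
  proof (rule inj_onI, rule ccontr)
    fix w v assume *: "w \<in> ?W" "v \<in> ?W" "point w = point v" "w \<noteq> v"
    then have ex: "\<exists>n. w n \<noteq> v n" by auto
    define n where "n = (LEAST n. w n \<noteq> v n)"
    have "w n \<noteq> v n" "\<forall>i<n. w i = v i"
      using LeastI_ex[OF ex] not_less_Least by (auto simp: n_def)
    then have "0 < dist (point w) (point v)"
      using bounds *(1,2) \<delta> r by (smt (verit) mult_pos_pos zero_less_power)
    then show False using *(3) by simp
  qed
  moreover have "point ` ?W = K"
  proof
    show "point ` ?W \<subseteq> K" using point_in_K overlap_free_subset by blast
    show "K \<subseteq> point ` ?W"
      using point_itinerary itinerary_overlap_free by (metis image_eqI subsetI)
  qed
  ultimately show ?thesis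
    unfolding bilipschitz_coding_def bij_betw_def using \<delta> bounds by blast
qed

end

section \<open>Comparing two codings\<close>

lemma bilipschitz_coding_isometry:
  assumes "bilipschitz_coding r W h K" and "\<And>x y. dist (g x) (g y) = dist x y"
  shows "bilipschitz_coding r W (g \<circ> h) (g ` K)"
proof -
  have "inj g" using assms(2) by (metis dist_eq_0_iff injI)
  then have "bij_betw (g \<circ> h) W (g ` K)"
    using assms(1) unfolding bilipschitz_coding_def
    by (meson bij_betw_imageI bij_betw_trans inj_on_subset subset_UNIV)
  then show ?thesis using assms unfolding bilipschitz_coding_def by simp
qed

text \<open>
  Composing codes letterwise with an injective map preserves the first place of disagreement, so
  distances in \<open>K\<close> and \<open>K'\<close> are comparable to the same power of \<open>r\<close>.
\<close>

lemma bilipschitz_codings_equivalent: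
  assumes r: "0 < r"
    and h: "bilipschitz_coding r W h K" and h': "bilipschitz_coding r W' h' K'"
    and s: "inj s" "bij_betw (\<lambda>w. s \<circ> w) W W'"
    and ne: "K \<noteq> {}"
  shows "K \<simeq>\<^sub>L K'"
proof -
  obtain \<delta> where \<delta>: "0 < \<delta>" "\<And>w v n. \<lbrakk>w \<in> W; v \<in> W; \<forall>i<n. w i = v i; w n \<noteq> v n\<rbrakk> \<Longrightarrow>
      \<delta> * r ^ n \<le> dist (h w) (h v) \<and> dist (h w) (h v) \<le> r ^ n"
    using h unfolding bilipschitz_coding_def by blast
  obtain \<delta>' where \<delta>': "0 < \<delta>'" "\<And>w v n. \<lbrakk>w \<in> W'; v \<in> W'; \<forall>i<n. w i = v i; w n \<noteq> v n\<rbrakk> \<Longrightarrow>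
      \<delta>' * r ^ n \<le> dist (h' w) (h' v) \<and> dist (h' w) (h' v) \<le> r ^ n"
    using h' unfolding bilipschitz_coding_def by blast
  have bij: "bij_betw h W K" "bij_betw h' W' K'"
    using h h' by (auto simp: bilipschitz_coding_def)
  define \<phi> where "\<phi> = h' \<circ> (\<lambda>w. s \<circ> w) \<circ> inv_into W h"
  have \<phi>: "bij_betw \<phi> K K'"
    unfolding \<phi>_def by (intro bij_betw_trans[OF bij_betw_inv_into[OF bij(1)]]
        bij_betw_trans[OF s(2)] bij(2) ) 
  define c where "c = inverse (min \<delta> \<delta>')"
  have c: "c > 0" using \<delta> \<delta>' by (simp add: c_def)
  have bound: "inverse c * dist x y \<le> dist (\<phi> x) (\<phi> y) \<and> dist (\<phi> x) (\<phi> y) \<le> c * dist x y"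
    if "x \<in> K" "y \<in> K" for x y
  proof (cases "x = y")
    case False
    obtain w v where w: "w \<in> W" "x = h w" and v: "v \<in> W" "y = h v"
      using \<open>x \<in> K\<close> \<open>y \<in> K\<close> bij_betw_imp_surj_on[OF bij(1)] by blast
    have \<phi>_eq: "\<phi> x = h' (s \<circ> w)" "\<phi> y = h' (s \<circ> v)"
      using w v bij(1) by (simp_all add: \<phi>_def bij_betw_inv_into_left)
    have W': "s \<circ> w \<in> W'" "s \<circ> v \<in> W'" using s(2) w v by (auto dest: bij_betwE)
    have "w \<noteq> v" using False w v by blast
    then have ex: "\<exists>n. w n \<noteq> v n" by auto
    define n where "n = (LEAST n. w n \<noteq> v n)"
    have n: "w n \<noteq> v n" "\<forall>i<n. w i = v i"
      using LeastI_ex[OF ex] not_less_Least by (auto simp: n_def)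
    have d: "\<delta> * r ^ n \<le> dist x y" "dist x y \<le> r ^ n"
      using \<delta>(2)[OF w(1) v(1) n(2,1)] w v by auto
    have d': "\<delta>' * r ^ n \<le> dist (\<phi> x) (\<phi> y)" "dist (\<phi> x) (\<phi> y) \<le> r ^ n"
      using \<delta>'(2)[OF W', of n] n s(1) by (auto simp: \<phi>_eq inj_eq)
    let ?q = "min \<delta> \<delta>'"
    have q: "?q > 0" using \<delta> \<delta>' by simp
    have "?q * dist x y \<le> \<delta>' * r ^ n" using d(2) \<delta>' by (intro mult_mono) auto
    then have "?q * dist x y \<le> dist (\<phi> x) (\<phi> y)" using d' by linarith
    moreover have "?q * dist (\<phi> x) (\<phi> y) \<le> \<delta> * r ^ n" using d'(2) \<delta> by (intro mult_mono) auto
    then have "?q * dist (\<phi> x) (\<phi> y) \<le> dist x y" using d by linarith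
    ultimately show ?thesis using q by (simp add: c_def field_simps)
  qed simp
  have "K' \<noteq> {}" using \<phi> ne by (auto simp: bij_betw_def)
  then show ?thesis unfolding lipschitz_equivalent_def using ne \<phi> c bound by blast
qed

text \<open>
  Forbidden words consist of a letter \<open>i < m\<close> followed by a number of letters \<open>m\<close> that depends on
  \<open>e i\<close> alone; a permutation of \<open>{1..<m}\<close> leaves \<open>m\<close> in place.
\<close>

lemma overlap_free_seqs_relabel:
  assumes p: "p permutes {1..<m}" and e: "\<forall>i\<in>{1..<m}. e i = e' (p i)"
  shows "bij_betw (\<lambda>w. p \<circ> w) (overlap_free_seqs m e) (overlap_free_seqs m e')"
proof -
  have sub: "q \<circ> w \<in> overlap_free_seqs m d'"
    if q: "q permutes {1..<m}" and d: "\<forall>i\<in>{1..<m}. d i = d' (q i)" and w: "w \<in> overlap_free_seqs m d"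
    for q d d' w
  proof -
    have m_iff: "q i = m \<longleftrightarrow> i = m" for i
      using q permutes_not_in[OF q, of m] by (metis atLeastLessThan_iff less_irrefl permutes_inj inj_eq)
    have "(q \<circ> w) n \<in> {1..m} \<and> ((q \<circ> w) n < m \<longrightarrow> d' ((q \<circ> w) n) \<noteq> 0 \<longrightarrow>
            (\<exists>p\<in>{1..<d' ((q \<circ> w) n)}. (q \<circ> w) (n + p) \<noteq> m))" for n
    proof (cases "w n = m")
      case True
      then have "(q \<circ> w) n = m" by (simp add: m_iff)
      moreover have "1 \<le> w n" using w by (auto simp: overlap_free_seqs_def)
      ultimately show ?thesis using True by simp
    next
      case False
      moreover have "w n \<in> {1..m}" using w unfolding overlap_free_seqs_def by blast
      ultimately have wn: "w n \<in> {1..<m}" by simp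
      then have "q (w n) \<in> {1..<m}" using permutes_in_image[OF q] by blast
      moreover have "\<exists>p\<in>{1..<d (w n)}. w (n + p) \<noteq> m" if "d (w n) \<noteq> 0"
        using w wn that by (auto simp: overlap_free_seqs_def)
      moreover have "d' (q (w n)) = d (w n)" using d wn by simp
      ultimately show ?thesis by (simp add: m_iff)
    qed
    then show ?thesis by (simp add: overlap_free_seqs_def)
  qed
  note q = permutes_inv[OF p]
  have e': "\<forall>i\<in>{1..<m}. e' i = e (inv p i)"
    using e permutes_in_image[OF q] permutes_inverses(1)[OF p] by metis
  show ?thesis
    by (rule bij_betw_byWitness[where f' = "\<lambda>w. inv p \<circ> w"])
      (auto simp: fun_eq_iff permutes_inverses[OF p] intro: sub[OF p e] sub[OF q e'])
qed

section \<open>Overlap exponents of admissible vectors\<close>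

lemma cell_eq:
  assumes "0 < r" shows "cell r a i = {a i..a i + r}"
proof -
  have "(\<lambda>x. r * x + a i) ` {0..1} = {r * 0 + a i..r * 1 + a i}"
    using assms by (simp add: image_affinity_atLeastAtMost)
  then show ?thesis by (simp add: cell_def ifs_map_def[abs_def] add.commute)
qed

definition overlap_profile :: "real \<Rightarrow> nat \<Rightarrow> (nat \<Rightarrow> real) \<Rightarrow> (nat \<Rightarrow> nat) \<Rightarrow> bool" where
  "overlap_profile r m a e \<longleftrightarrow> (\<forall>i\<in>{1..<m}.
     if e i = 0 then a i + r < a (i + 1) else a (i + 1) = a i + r - r ^ e i)"

lemma admissible_overlap_profile:
  assumes r: "0 < r" "r < 1" and m: "2 \<le> m"
    and k: "\<And>l. l \<in> {1..n} \<Longrightarrow> k l \<noteq> 0"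
    and a: "a \<in> admissible_vectors r m n k"
  obtains e where "overlap_profile r m a e" "e 1 = 0 \<or> e (m - 1) = 0"
    "e ` {1..<m} \<subseteq> insert 0 (k ` {1..n})"
    "\<forall>l\<in>{1..n}. {i \<in> {1..<m}. e i = k l} = overlap_indices r m k l a"
proof -
  have mono: "strict_mono_on {1..m} a"
    and pair: "\<And>i j. i \<in> {1..m} \<Longrightarrow> j \<in> {1..m} \<Longrightarrow> i < j \<Longrightarrow> cell r a i \<inter> cell r a j \<noteq> {} \<Longrightarrow>
        measure lborel (cell r a i \<inter> cell r a j) \<in> (\<lambda>l. r ^ k l) ` {1..n}"
    and ends: "(\<forall>j\<in>{1..m}. j > 1 \<longrightarrow> cell r a 1 \<inter> cell r a j = {}) \<or>
      (\<forall>j\<in>{1..m}. j < m \<longrightarrow> cell r a m \<inter> cell r a j = {})"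
    using a unfolding admissible_vectors_def by blast+
  have lt: "a i < a (i + 1)" if "i \<in> {1..<m}" for i
    using that by (intro strict_mono_onD[OF mono]) auto
  have inter: "cell r a i \<inter> cell r a (i + 1) = {a (i + 1)..a i + r}" if "i \<in> {1..<m}" for i
    using lt[OF that] r by (auto simp: cell_eq)
  have "\<forall>i\<in>{1..<m}. \<exists>v\<in>insert 0 (k ` {1..n}).
      if v = 0 then a i + r < a (i + 1) else a (i + 1) = a i + r - r ^ v"
  proof
    fix i assume i: "i \<in> {1..<m}"
    show "\<exists>v\<in>insert 0 (k ` {1..n}).
      if v = 0 then a i + r < a (i + 1) else a (i + 1) = a i + r - r ^ v"
    proof (cases "a i + r < a (i + 1)")
      case False
      then have "measure lborel {a (i + 1)..a i + r} \<in> (\<lambda>l. r ^ k l) ` {1..n}"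
        using pair[of i "i + 1"] i inter[OF i] by auto
      then obtain l where "l \<in> {1..n}" "a i + r - a (i + 1) = r ^ k l" using False by auto
      then show ?thesis using k[of l] by (intro bexI[of _ "k l"]) auto
    qed auto
  qed
  then obtain e where e: "\<forall>i\<in>{1..<m}. e i \<in> insert 0 (k ` {1..n}) \<and>
      (if e i = 0 then a i + r < a (i + 1) else a (i + 1) = a i + r - r ^ e i)"
    by (metis (lifting))
  have e_zero: "e i = 0" if "i \<in> {1..<m}" "cell r a i \<inter> cell r a (i + 1) = {}" for i
  proof (rule ccontr)
    assume "e i \<noteq> 0"
    then have "a (i + 1) = a i + r - r ^ e i" using bspec[OF e that(1)] by simp
    moreover have "0 < r ^ e i" using r by simp
    ultimately show False using that inter[OF that(1)] by auto
  qed
  show thesis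
  proof (rule that[of e])
    show "overlap_profile r m a e" "e ` {1..<m} \<subseteq> insert 0 (k ` {1..n})"
      using e by (auto simp: overlap_profile_def)
    show "e 1 = 0 \<or> e (m - 1) = 0"
      using ends
    proof
      assume "\<forall>j\<in>{1..m}. j > 1 \<longrightarrow> cell r a 1 \<inter> cell r a j = {}"
      then have "e 1 = 0" using m by (intro e_zero) auto
      then show ?thesis ..
    next
      assume "\<forall>j\<in>{1..m}. j < m \<longrightarrow> cell r a m \<inter> cell r a j = {}"
      moreover have "m - 1 \<in> {1..m}" "m - 1 < m" "m - 1 + 1 = m" using m by auto
      ultimately have "cell r a (m - 1) \<inter> cell r a (m - 1 + 1) = {}"
        by (metis Int_commute)
      then have "e (m - 1) = 0" using m by (intro e_zero) auto
      then show ?thesis ..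
    qed
    show "\<forall>l\<in>{1..n}. {i \<in> {1..<m}. e i = k l} = overlap_indices r m k l a"
    proof
      fix l assume l: "l \<in> {1..n}"
      have "e i = k l \<longleftrightarrow> measure lborel (cell r a i \<inter> cell r a (i + 1)) = r ^ k l"
        if i: "i \<in> {1..<m}" for i
      proof (cases "e i = 0")
        case True
        then have "a i + r < a (i + 1)" using bspec[OF e i] by simp
        then show ?thesis unfolding inter[OF i] using True k[OF l] r by simp
      next
        case False
        then have eq: "a (i + 1) = a i + r - r ^ e i" using bspec[OF e i] by simp
        have "measure lborel {a (i + 1)..a i + r} = r ^ e i"
          unfolding eq using r by simp
        then show ?thesis unfolding inter[OF i] using r by (simp add: power_inject_exp')
      qed
      moreover have "{1..m - 1} = {1..<m}" using m by auto
      ultimately show "{i \<in> {1..<m}. e i = k l} = overlap_indices r m k l a"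
        unfolding overlap_indices_def by auto
    qed
  qed
qed

text \<open>
  The reflection \<open>x \<mapsto> 1 - x\<close> conjugates \<open>x \<mapsto> r * x + c\<close> to \<open>x \<mapsto> r * x + (1 - r - c)\<close>; reversing
  the indices keeps the translations in increasing order.
\<close>

lemma attractor_reflect:
  assumes "attractor r m a K"
  shows "attractor r m (\<lambda>i. 1 - r - a (m + 1 - i)) ((\<lambda>x. 1 - x) ` K)"
proof -
  have K: "K \<noteq> {}" "compact K" "K = (\<Union>i\<in>{1..m}. ifs_map r a i ` K)"
    using assms unfolding attractor_def by blast+
  let ?b = "\<lambda>i. 1 - r - a (m + 1 - i)"
  have refl: "ifs_map r ?b i (1 - x) = 1 - ifs_map r a (m + 1 - i) x" for i x
    by (simp add: ifs_map_def algebra_simps)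
  have "bij_betw (\<lambda>i. m + 1 - i) {1..m} {1..m}"
    by (rule bij_betw_byWitness[where f' = "\<lambda>i. m + 1 - i"]) auto
  then have idx: "(\<lambda>i. m + 1 - i) ` {1..m} = {1..m}" by (rule bij_betw_imp_surj_on)
  have "(\<lambda>x. 1 - x) ` K = (\<Union>i\<in>{1..m}. (\<lambda>x. 1 - x) ` ifs_map r a i ` K)"
    by (subst K(3)) (simp add: image_UN)
  also have "\<dots> = (\<Union>i\<in>(\<lambda>i. m + 1 - i) ` {1..m}. (\<lambda>x. 1 - x) ` ifs_map r a i ` K)"
    by (simp only: idx)
  also have "\<dots> = (\<Union>i\<in>{1..m}. ifs_map r ?b i ` (\<lambda>x. 1 - x) ` K)"
    by (simp only: image_image refl)
  finally have "(\<lambda>x. 1 - x) ` K = (\<Union>i\<in>{1..m}. ifs_map r ?b i ` (\<lambda>x. 1 - x) ` K)" .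
  moreover have "compact ((\<lambda>x. 1 - x) ` K)"
    using K(2) by (intro compact_continuous_image continuous_intros)
  ultimately show ?thesis using K(1) unfolding attractor_def by blast
qed

text \<open>
  The symbolic space is that of \<open>e\<close> itself if the last cell is isolated, and that of the reversed
  profile \<open>i \<mapsto> e (m - i)\<close> of the reflected system otherwise. In both cases the multiset of exponents
  is unchanged.
\<close>

lemma overlap_profile_coding:
  assumes r: "0 < r" "r < 1" and m: "2 \<le> m"
    and a: "a 1 = 0" "strict_mono_on {1..m} a" "a m = 1 - r"
    and e: "overlap_profile r m a e" "e 1 = 0 \<or> e (m - 1) = 0"
  obtains d h where
    "image_mset d (mset_set {1..<m}) = image_mset e (mset_set {1..<m})"
    "bilipschitz_coding r (overlap_free_seqs m d) h (self_similar_set r m a)"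
    "self_similar_set r m a \<noteq> {}"
proof -
  let ?K = "self_similar_set r m a"
  have mono: "a i \<le> a j" if "1 \<le> i" "i \<le> j" "j \<le> m" for i j
    using strict_mono_on_leD[OF a(2)] that by auto
  have K: "attractor r m a ?K"
  proof (rule attractor_self_similar_set[OF r])
    show "0 \<le> a i \<and> a i \<le> 1 - r" if "i \<in> {1..m}" for i
      using mono[of 1 i] mono[of i m] a m that by auto
  qed (use m a in auto)
  show thesis
  proof (cases "e (m - 1) = 0")
    case True
    have prof: "if e i = 0 then a i + r < a (i + 1) else a (i + 1) = a i + r - r ^ e i"
      if "1 \<le> i" "i < m" for i
      using bspec[OF e(1)[unfolded overlap_profile_def], of i] that by simp
    interpret exact_overlap_ifs r m a e ?K
    proof unfold_locales
      show "a i + r < a (i + 1)" if "1 \<le> i" "i < m" "e i = 0" for i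
        using prof[of i] that by simp
      show "a (i + 1) = a i + r - r ^ e i" if "1 \<le> i" "i < m" "e i \<noteq> 0" for i
        using prof[of i] that by simp
    qed (use r m a True mono K in auto)
    show thesis by (rule that[OF refl coding K_nonempty])
  next
    case False
    let ?b = "\<lambda>i. 1 - r - a (m + 1 - i)" and ?d = "\<lambda>i. e (m - i)"
    have prof: "if ?d i = 0 then ?b i + r < ?b (i + 1) else ?b (i + 1) = ?b i + r - r ^ ?d i"
      if i: "1 \<le> i" "i < m" for i
    proof -
      have "m - i \<in> {1..<m}" "m - i + 1 = m + 1 - i" "m + 1 - (i + 1) = m - i" using i by auto
      then show ?thesis using e(1) unfolding overlap_profile_def by (force split: if_splits)
    qed
    interpret exact_overlap_ifs r m ?b ?d "(\<lambda>x. 1 - x) ` ?K"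
    proof unfold_locales
      show "?b i \<le> ?b j" if "1 \<le> i" "i \<le> j" "j \<le> m" for i j
        using mono[of "m + 1 - j" "m + 1 - i"] that by auto
      show "?d (m - 1) = 0" using e(2) False m by simp
      show "attractor r m ?b ((\<lambda>x. 1 - x) ` ?K)" by (rule attractor_reflect[OF K])
      show "?b i + r < ?b (i + 1)" if "1 \<le> i" "i < m" "?d i = 0" for i
        using prof[of i] that by simp
      show "?b (i + 1) = ?b i + r - r ^ ?d i" if "1 \<le> i" "i < m" "?d i \<noteq> 0" for i
        using prof[of i] that by simp
    qed (use r m a in auto)
    have "bilipschitz_coding r (overlap_free_seqs m ?d) ((\<lambda>x. 1 - x) \<circ> point)
        ((\<lambda>x. 1 - x) ` (\<lambda>x. 1 - x) ` ?K)"
      by (intro bilipschitz_coding_isometry coding) (simp add: dist_real_def abs_minus_commute)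
    then have cod: "bilipschitz_coding r (overlap_free_seqs m ?d) ((\<lambda>x. 1 - x) \<circ> point) ?K"
      by (simp add: image_image)
    have "bij_betw (\<lambda>i. m - i) {1..<m} {1..<m}"
      by (rule bij_betw_byWitness[where f' = "\<lambda>i. m - i"]) auto
    then have "image_mset (\<lambda>i. m - i) (mset_set {1..<m}) = mset_set {1..<m}"
      by (simp add: image_mset_mset_set bij_betw_def)
    then have "image_mset ?d (mset_set {1..<m}) = image_mset e (mset_set {1..<m})"
      by (metis (no_types, lifting) multiset.map_comp comp_def multiset.map_cong0)
    then show thesis using cod K_nonempty by (intro that) auto
  qed
qed

text \<open>
  Equal fibres over all values but one suffice, because the sizes of all fibres add up to the size
  of \<open>A\<close>. The exceptional value will be the exponent \<open>0\<close> of disjoint neighbours, which the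
  hypothesis on overlaps does not count.
\<close>

lemma image_mset_eqI_card_fibres:
  assumes "finite A" and "f ` A \<subseteq> insert z V" "g ` A \<subseteq> insert z V" and "z \<notin> V"
    and V: "\<And>v. v \<in> V \<Longrightarrow> card {x \<in> A. f x = v} = card {x \<in> A. g x = v}"
  shows "image_mset f (mset_set A) = image_mset g (mset_set A)"
proof (rule multiset_eqI)
  have fibre: "count (image_mset f (mset_set A)) v = card {x \<in> A. f x = v}" for f v
    using assms(1) by (simp add: count_image_mset' eq_commute)
  fix v
  have out: "card {x \<in> A. f x = v} = 0" "card {x \<in> A. g x = v} = 0" if "v \<notin> insert z V"
    using assms(2,3) that by (auto simp: card_eq_0_iff)
  have z: "card {x \<in> A. f x = z} + card {x \<in> A. f x \<in> V} = card A"
    if "f ` A \<subseteq> insert z V" for f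
  proof -
    have "card ({x \<in> A. f x = z} \<union> {x \<in> A. f x \<in> V}) =
        card {x \<in> A. f x = z} + card {x \<in> A. f x \<in> V}"
      using assms(1,4) by (intro card_Un_disjoint) auto
    moreover have "{x \<in> A. f x = z} \<union> {x \<in> A. f x \<in> V} = A" using that by auto
    ultimately show ?thesis by simp
  qed
  define V' where "V' = V \<inter> (f ` A \<union> g ` A)"
  have UN: "{x \<in> A. f x \<in> V} = (\<Union>v\<in>V'. {x \<in> A. f x = v})"
    "{x \<in> A. g x \<in> V} = (\<Union>v\<in>V'. {x \<in> A. g x = v})"
    by (auto simp: V'_def)
  have "finite V'" using assms(1) by (simp add: V'_def)
  then have "card {x \<in> A. f x \<in> V} = (\<Sum>v\<in>V'. card {x \<in> A. f x = v})"
    "card {x \<in> A. g x \<in> V} = (\<Sum>v\<in>V'. card {x \<in> A. g x = v})"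
    unfolding UN using assms(1) by (intro card_UN_disjoint; auto)+
  moreover have "(\<Sum>v\<in>V'. card {x \<in> A. f x = v}) = (\<Sum>v\<in>V'. card {x \<in> A. g x = v})"
    using V by (intro sum.cong) (auto simp: V'_def)
  ultimately have V_eq: "card {x \<in> A. f x \<in> V} = card {x \<in> A. g x \<in> V}" by simp
  show "count (image_mset f (mset_set A)) v = count (image_mset g (mset_set A)) v"
    using out V z[OF assms(2)] z[OF assms(3)] V_eq unfolding fibre by (cases "v = z"; cases "v \<in> V") auto
qed

theorem theorem1p1:
  fixes r :: real and m n :: nat and k :: "nat \<Rightarrow> nat" and a b :: "nat \<Rightarrow> real"
  assumes "0 < r" and "r < 1"
    and "m \<ge> 3"
    and "n \<ge> 1"
    and "\<And>i j. 1 \<le> i \<Longrightarrow> i < j \<Longrightarrow> j \<le> n \<Longrightarrow> k j < k i"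
    and "k n \<ge> 2"
    and "a \<in> admissible_vectors r m n k"
    and "b \<in> admissible_vectors r m n k"
    and "\<And>l. 1 \<le> l \<Longrightarrow> l \<le> n \<Longrightarrow>
           card (overlap_indices r m k l a) = card (overlap_indices r m k l b)"
  shows "self_similar_set r m a \<simeq>\<^sub>L self_similar_set r m b"
proof -
  have m: "2 \<le> m" using assms(3) by simp
  have k: "k l \<noteq> 0" if "l \<in> {1..n}" for l
    using assms(5)[of l n] assms(6) that by (cases "l = n") auto
  obtain ea where ea: "overlap_profile r m a ea" "ea 1 = 0 \<or> ea (m - 1) = 0"
    "ea ` {1..<m} \<subseteq> insert 0 (k ` {1..n})"
    "\<forall>l\<in>{1..n}. {i \<in> {1..<m}. ea i = k l} = overlap_indices r m k l a"
    by (rule admissible_overlap_profile[OF assms(1,2) m k assms(7)])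
  obtain eb where eb: "overlap_profile r m b eb" "eb 1 = 0 \<or> eb (m - 1) = 0"
    "eb ` {1..<m} \<subseteq> insert 0 (k ` {1..n})"
    "\<forall>l\<in>{1..n}. {i \<in> {1..<m}. eb i = k l} = overlap_indices r m k l b"
    by (rule admissible_overlap_profile[OF assms(1,2) m k assms(8)])
  have ends: "x 1 = 0" "strict_mono_on {1..m} x" "x m = 1 - r"
    if "x \<in> admissible_vectors r m n k" for x
    using that unfolding admissible_vectors_def by blast+
  obtain da ha where da: "image_mset da (mset_set {1..<m}) = image_mset ea (mset_set {1..<m})"
    and ha: "bilipschitz_coding r (overlap_free_seqs m da) ha (self_similar_set r m a)"
    and ne: "self_similar_set r m a \<noteq> {}"
    by (rule overlap_profile_coding[OF assms(1,2) m ends[OF assms(7)] ea(1,2)])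
  obtain db hb where db: "image_mset db (mset_set {1..<m}) = image_mset eb (mset_set {1..<m})"
    and hb: "bilipschitz_coding r (overlap_free_seqs m db) hb (self_similar_set r m b)"
    by (rule overlap_profile_coding[OF assms(1,2) m ends[OF assms(8)] eb(1,2)])
  have "image_mset ea (mset_set {1..<m}) = image_mset eb (mset_set {1..<m})"
  proof (rule image_mset_eqI_card_fibres[OF _ ea(3) eb(3)])
    show "0 \<notin> k ` {1..n}" using k by fastforce
    show "card {i \<in> {1..<m}. ea i = v} = card {i \<in> {1..<m}. eb i = v}" if "v \<in> k ` {1..n}" for v
      using that ea(4) eb(4) assms(9) by fastforce
  qed simp
  then obtain p where p: "p permutes {1..<m}" "\<forall>i\<in>{1..<m}. da i = db (p i)"
    using image_mset_eq_implies_permutes[of "{1..<m}" da db] da db by auto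
  show ?thesis
    using bilipschitz_codings_equivalent[OF assms(1) ha hb permutes_inj[OF p(1)]
        overlap_free_seqs_relabel[OF p] ne] .
qed

end
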